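(* For any $B\in\mathcal{PC}_{n-1}$ and any $w\in\mathcal{V}_n$, there is a matrix $A\in\mathcal{PC}_n$ with Perron vector $w$ and such that $A(n)=B$. Moreover, $A$ is unique.
   Context: $n\ge 2$. $\mathcal{PC}_n$ denotes the set of $n\times n$ reciprocal matrices, i.e. real matrices $A=[a_{ij}]$ with all entries positive and $a_{ji}=1/a_{ij}$ for all $i,j$ (so $a_{ii}=1$). $\mathcal{V}_n$ denotes the set of entrywise positive real $n$-vectors. The Perron vector of a positive square matrix $A$ is any entrywise positive (right) eigenvector of $A$; it is unique up to a positive scalar multiple and is associated with the spectral radius. $A(n)$ is the principal submatrix of $A$ obtained by deleting row and column $n$. *)

theory Defs
  imports Complex_Main "Jordan_Normal_Form.Determinant" "Jordan_Normal_Form.Char_Poly"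
begin

definition positive_vecs :: "nat \<Rightarrow> real vec set" where
  "positive_vecs n = {w \<in> carrier_vec n. \<forall>i<n. 0 < w $ i}"

definition reciprocal_mats :: "nat \<Rightarrow> real mat set" where
  "reciprocal_mats n =
     {A \<in> carrier_mat n n. \<forall>i<n. \<forall>j<n. 0 < A $$ (i, j) \<and> A $$ (j, i) = 1 / A $$ (i, j)}"

(* Meant for square matrices with positive entries. The eigenvalue is left existential:
   that it is the spectral radius is a consequence of the Perron-Frobenius theorem. *)
definition perron_vector :: "real mat \<Rightarrow> real vec \<Rightarrow> bool" where
  "perron_vector A w \<longleftrightarrow> w \<in> positive_vecs (dim_row A) \<and> (\<exists>r. eigenvector A w r)"

end

theory Submission
  imports Defs
begin

text \<open>
  Put \<open>n = Suc m\<close>. A reciprocal matrix \<open>A\<close> with leading block \<open>B\<close> is determined by the entries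
  \<open>x i > 0\<close> of its last column above the diagonal: the last row is then \<open>1 / x i\<close>, and the corner
  is 1. Write \<open>c i = (\<Sum>j<m. B i j * w j) / w i\<close> for the row sums of the block after scaling it
  by \<open>w\<close>. The first \<open>m\<close> rows of \<open>A w = r w\<close> can be solved for the border,
  \<open>x i = w i / w m * (r - c i)\<close>,
  and substituting this into the last row leaves the single scalar equation
  \<open>(\<Sum>i<m. 1 / (r - c i)) = r - 1\<close>
  (lemma \<open>eigenvector_iff_border\<close>). So the suitable matrices correspond to the solutions \<open>r\<close>
  of this equation for which the border is positive, that is, for which \<open>r\<close> exceeds every
  \<open>c i\<close>. To the right of the poles \<open>c i\<close> the left side falls strictly from infinity to 0, whereas
  the right side increases, so there is exactly one such \<open>r\<close> (lemma \<open>secular_equation_ex1\<close>).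
\<close>

section \<open>The scalar equation for the eigenvalue\<close>

text \<open>
  Uniqueness is the opposite monotonicity of the two sides. For existence the intermediate value
  theorem applies between a point so close to the largest pole \<open>M\<close> that the term of this pole
  alone exceeds the right side, and a point so far to the right that every term is at most 1.
\<close>

lemma secular_equation_ex1:
  fixes c :: "'a \<Rightarrow> real"
  assumes fin: "finite I" and ne: "I \<noteq> {}" and c: "\<And>i. i \<in> I \<Longrightarrow> 0 \<le> c i"
  shows "\<exists>!r. (\<forall>i\<in>I. c i < r) \<and> (\<Sum>i\<in>I. 1 / (r - c i)) = r - 1"
proof (rule ex_ex1I)
  define M where "M = Max (c ` I)"
  have M_ge: "c i \<le> M" if "i \<in> I" for i
    unfolding M_def using that fin by simp
  have "M \<in> c ` I"
    unfolding M_def using fin ne by (intro Max_in) auto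
  then obtain k where k: "k \<in> I" "c k = M" by auto
  have M0: "0 \<le> M" using c k by force
  define g where "g r = (\<Sum>i\<in>I. 1 / (r - c i)) - (r - 1)" for r
  \<comment> \<open>At \<open>a\<close> the term of the largest pole is \<open>M + 1\<close>, at least \<open>a - 1\<close>; at \<open>b\<close>, at
    distance at least 1 from all poles, the sum is at most \<open>card I\<close>, hence at most \<open>b - 1\<close>.\<close>
  define a where "a = M + 1 / (M + 1)"
  define b where "b = M + real (card I) + 1"
  have aM: "M < a" unfolding a_def using M0 by simp
  have "1 / (M + 1) \<le> 1" using M0 by simp
  then have a_le: "a \<le> M + 1" unfolding a_def by simp
  have ab: "a \<le> b" using a_le unfolding b_def by simp
  have "1 / (a - c k) \<le> (\<Sum>i\<in>I. 1 / (a - c i))"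
  proof (rule member_le_sum[OF k(1) _ fin])
    fix i assume "i \<in> I - {k}"
    then have "c i \<le> a" using M_ge[of i] aM by simp
    then show "0 \<le> 1 / (a - c i)" by simp
  qed
  moreover have "1 / (a - c k) = M + 1" unfolding k a_def by simp
  ultimately have ga: "0 \<le> g a" unfolding g_def using a_le by simp
  have "1 / (b - c i) \<le> 1" if "i \<in> I" for i
    using M_ge[OF that] unfolding b_def by simp
  then have "(\<Sum>i\<in>I. 1 / (b - c i)) \<le> (\<Sum>i\<in>I. 1)" by (rule sum_mono)
  then have gb: "g b \<le> 0" unfolding g_def b_def using M0 by simp
  have cont: "continuous_on {a..b} g"
    unfolding g_def using aM M_ge by (intro continuous_intros) force
  from IVT2'[of g b 0 a, OF gb ga ab cont]
  obtain r where "a \<le> r" "g r = 0" by blast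
  then show "\<exists>r. (\<forall>i\<in>I. c i < r) \<and> (\<Sum>i\<in>I. 1 / (r - c i)) = r - 1"
    using aM M_ge unfolding g_def by (intro exI[of _ r]) force
next
  have no_less: False
    if less: "r < s" and r: "\<forall>i\<in>I. c i < r" "(\<Sum>i\<in>I. 1 / (r - c i)) = r - 1"
      and s: "(\<Sum>i\<in>I. 1 / (s - c i)) = s - 1" for r s
  proof -
    have "(\<Sum>i\<in>I. 1 / (s - c i)) \<le> (\<Sum>i\<in>I. 1 / (r - c i))"
      using less r(1) by (intro sum_mono frac_le) auto
    then show False using less r(2) s by simp
  qed
  fix r s
  assume "(\<forall>i\<in>I. c i < r) \<and> (\<Sum>i\<in>I. 1 / (r - c i)) = r - 1"
    and "(\<forall>i\<in>I. c i < s) \<and> (\<Sum>i\<in>I. 1 / (s - c i)) = s - 1"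
  then show "r = s"
    using no_less[of r s] no_less[of s r] by (cases r s rule: linorder_cases) blast+
qed

section \<open>Bordering a reciprocal matrix\<close>

definition reciprocal_border :: "nat \<Rightarrow> real mat \<Rightarrow> (nat \<Rightarrow> real) \<Rightarrow> real mat" where
  "reciprocal_border m B x = mat (Suc m) (Suc m) (\<lambda>(i, j).
     if i < m then (if j < m then B $$ (i, j) else x i) else if j < m then 1 / x j else 1)"

lemma reciprocal_matsD:
  assumes "A \<in> reciprocal_mats n"
  shows "A \<in> carrier_mat n n"
    and "i < n \<Longrightarrow> j < n \<Longrightarrow> 0 < A $$ (i, j)"
    and "i < n \<Longrightarrow> j < n \<Longrightarrow> A $$ (j, i) = 1 / A $$ (i, j)"
  using assms unfolding reciprocal_mats_def by blast+

lemma reciprocal_mats_diag: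
  assumes "A \<in> reciprocal_mats n" "i < n"
  shows "A $$ (i, i) = 1"
proof -
  have "0 < A $$ (i, i)" "A $$ (i, i) = 1 / A $$ (i, i)"
    using reciprocal_matsD[OF assms(1)] assms(2) by blast+
  then have "(A $$ (i, i))\<^sup>2 = 1"
    unfolding power2_eq_square by (metis less_irrefl nonzero_eq_divide_eq)
  then show ?thesis using \<open>0 < A $$ (i, i)\<close> by (simp add: power2_eq_1_iff)
qed

lemma reciprocal_border_reciprocal:
  assumes "B \<in> reciprocal_mats m" and "\<And>i. i < m \<Longrightarrow> 0 < x i"
  shows "reciprocal_border m B x \<in> reciprocal_mats (Suc m)"
proof -
  have "0 < reciprocal_border m B x $$ (i, j)
      \<and> reciprocal_border m B x $$ (j, i) = 1 / reciprocal_border m B x $$ (i, j)"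
    if "i < Suc m" "j < Suc m" for i j
    using that assms(2) reciprocal_matsD(2,3)[OF assms(1), of i j]
    by (simp add: reciprocal_border_def)
  moreover have "reciprocal_border m B x \<in> carrier_mat (Suc m) (Suc m)"
    by (simp add: reciprocal_border_def)
  ultimately show ?thesis unfolding reciprocal_mats_def by blast
qed

lemma mat_delete_reciprocal_border:
  assumes "B \<in> carrier_mat m m"
  shows "mat_delete (reciprocal_border m B x) m m = B"
  using assms by (intro eq_matI) (auto simp: mat_delete_def reciprocal_border_def)

lemma reciprocal_mat_eq_border:
  assumes A: "A \<in> reciprocal_mats (Suc m)" and x: "\<And>i. i < m \<Longrightarrow> A $$ (i, m) = x i"
  shows "A = reciprocal_border m (mat_delete A m m) x"
proof (rule eq_matI)
  have dim: "A \<in> carrier_mat (Suc m) (Suc m)"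
    using A by (rule reciprocal_matsD)
  then show "dim_row A = dim_row (reciprocal_border m (mat_delete A m m) x)"
    "dim_col A = dim_col (reciprocal_border m (mat_delete A m m) x)"
    by (simp_all add: reciprocal_border_def)
  fix i j
  assume "i < dim_row (reciprocal_border m (mat_delete A m m) x)"
    and "j < dim_col (reciprocal_border m (mat_delete A m m) x)"
  then have ij: "i < Suc m" "j < Suc m" by (simp_all add: reciprocal_border_def)
  have row: "A $$ (m, j) = 1 / x j" if "j < m" for j
  proof -
    have "A $$ (m, j) = 1 / A $$ (j, m)"
      using that by (intro reciprocal_matsD[OF A]) auto
    then show ?thesis using x that by simp
  qed
  have "A $$ (m, m) = 1" using reciprocal_mats_diag[OF A] by simp
  then show "A $$ (i, j) = reciprocal_border m (mat_delete A m m) x $$ (i, j)"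
    using ij dim x row by (auto simp: reciprocal_border_def mat_delete_def less_Suc_eq)
qed

section \<open>The eigenvector equation of a bordered matrix\<close>

text \<open>
  Each of the first \<open>m\<close> rows of \<open>A w = r w\<close> is linear in one entry of the last column.
  Since the last row of \<open>A\<close> consists of the inverses of these entries, substituting the solutions
  turns the last row into \<open>w m * (\<Sum>i<m. 1 / (r - c i)) + w m = r * w m\<close>.
\<close>

lemma eigenvector_iff_border:
  fixes A :: "real mat" and w :: "real vec"
  assumes A: "A \<in> reciprocal_mats (Suc m)" and w: "w \<in> positive_vecs (Suc m)"
  defines "c \<equiv> \<lambda>i. (\<Sum>j<m. A $$ (i, j) * w $ j) / w $ i"
  shows "eigenvector A w r \<longleftrightarrow>
    (\<forall>i<m. A $$ (i, m) = w $ i / w $ m * (r - c i)) \<and> (\<Sum>i<m. 1 / (r - c i)) = r - 1"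
proof -
  have dim: "A \<in> carrier_mat (Suc m) (Suc m)" "w \<in> carrier_vec (Suc m)"
    using reciprocal_matsD(1)[OF A] w unfolding positive_vecs_def by auto
  have pos: "0 < w $ i" if "i < Suc m" for i
    using w that unfolding positive_vecs_def by simp
  have nz: "w $ m \<noteq> 0" using pos[of m] by simp
  have "w \<noteq> 0\<^sub>v (Suc m)" using pos[of m] by auto
  then have "eigenvector A w r \<longleftrightarrow> A *\<^sub>v w = r \<cdot>\<^sub>v w"
    using dim unfolding eigenvector_def by auto
  also have "\<dots> \<longleftrightarrow> (\<forall>i<Suc m. (\<Sum>j<Suc m. A $$ (i, j) * w $ j) = r * w $ i)"
    using dim by (auto simp: vec_eq_iff scalar_prod_def atLeast0LessThan)
  also have "\<dots> \<longleftrightarrow> (\<forall>i<m. (\<Sum>j<m. A $$ (i, j) * w $ j) + A $$ (i, m) * w $ m = r * w $ i)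
      \<and> (\<Sum>j<m. A $$ (m, j) * w $ j) + w $ m = r * w $ m"
    using reciprocal_mats_diag[OF A, of m] by (auto simp: less_Suc_eq)
  also have "\<dots> \<longleftrightarrow> (\<forall>i<m. A $$ (i, m) = w $ i / w $ m * (r - c i))
      \<and> (\<Sum>j<m. A $$ (m, j) * w $ j) + w $ m = r * w $ m"
  proof -
    have "(\<Sum>j<m. A $$ (i, j) * w $ j) + A $$ (i, m) * w $ m = r * w $ i
        \<longleftrightarrow> A $$ (i, m) = w $ i / w $ m * (r - c i)" if "i < m" for i
    proof -
      have "(\<Sum>j<m. A $$ (i, j) * w $ j) = w $ i * c i"
        using pos[of i] that unfolding c_def by simp
      then show ?thesis using nz by (auto simp: field_simps)
    qed
    then show ?thesis by auto
  qed
  also have "\<dots> \<longleftrightarrow> (\<forall>i<m. A $$ (i, m) = w $ i / w $ m * (r - c i))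
      \<and> (\<Sum>i<m. 1 / (r - c i)) = r - 1"
  proof (rule conj_cong[OF refl])
    assume col: "\<forall>i<m. A $$ (i, m) = w $ i / w $ m * (r - c i)"
    have "A $$ (m, j) * w $ j = w $ m * (1 / (r - c j))" if "j < m" for j
    proof -
      have "A $$ (m, j) = 1 / A $$ (j, m)"
        using that by (intro reciprocal_matsD[OF A]) auto
      then show ?thesis using col that pos[of j] by simp
    qed
    then have "(\<Sum>j<m. A $$ (m, j) * w $ j) = w $ m * (\<Sum>j<m. 1 / (r - c j))"
      unfolding sum_distrib_left by (intro sum.cong) auto
    then have "(\<Sum>j<m. A $$ (m, j) * w $ j) + w $ m = r * w $ m
        \<longleftrightarrow> w $ m * (\<Sum>j<m. 1 / (r - c j)) = w $ m * (r - 1)"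
      by (auto simp: algebra_simps)
    then show "(\<Sum>j<m. A $$ (m, j) * w $ j) + w $ m = r * w $ m
        \<longleftrightarrow> (\<Sum>j<m. 1 / (r - c j)) = r - 1"
      using nz by simp
  qed
  finally show ?thesis .
qed

section \<open>Existence and uniqueness of the bordered matrix\<close>

theorem theorem16:
  fixes n :: nat and B :: "real mat" and w :: "real vec"
  assumes "n \<ge> 2"
    and "B \<in> reciprocal_mats (n - 1)"
    and "w \<in> positive_vecs n"
  shows "\<exists>!A. A \<in> reciprocal_mats n \<and> perron_vector A w \<and> mat_delete A (n - 1) (n - 1) = B"
proof -
  obtain m where n: "n = Suc m" and m: "0 < m"
    using assms(1) by (cases n) auto
  have B: "B \<in> reciprocal_mats m" and w: "w \<in> positive_vecs (Suc m)"
    using assms n by auto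
  have pos: "0 < w $ i" if "i < Suc m" for i
    using w that unfolding positive_vecs_def by simp
  define c where "c i = (\<Sum>j<m. B $$ (i, j) * w $ j) / w $ i" for i
  define x where "x r i = w $ i / w $ m * (r - c i)" for r i
  have c0: "0 \<le> c i" if "i < m" for i
    unfolding c_def using reciprocal_matsD(2)[OF B] pos that
    by (intro divide_nonneg_nonneg sum_nonneg mult_nonneg_nonneg less_imp_le) auto
  have secular: "\<exists>!r. (\<forall>i\<in>{..<m}. c i < r) \<and> (\<Sum>i<m. 1 / (r - c i)) = r - 1"
    using m c0 by (intro secular_equation_ex1) auto
  have x_pos: "0 < x r i \<longleftrightarrow> c i < r" if "i < m" for r i
    using pos[of i] pos[of m] that unfolding x_def
    by (simp add: zero_less_mult_iff zero_less_divide_iff)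
  have eigen: "eigenvector A w r \<longleftrightarrow>
      (\<forall>i<m. A $$ (i, m) = x r i) \<and> (\<Sum>i<m. 1 / (r - c i)) = r - 1"
    if A: "A \<in> reciprocal_mats (Suc m)" and del: "mat_delete A m m = B" for A r
  proof -
    have "A \<in> carrier_mat (Suc m) (Suc m)" using A by (rule reciprocal_matsD)
    then have "B $$ (i, j) = A $$ (i, j)" if "i < m" "j < m" for i j
      using that unfolding del[symmetric] by (simp add: mat_delete_def)
    then have "c i = (\<Sum>j<m. A $$ (i, j) * w $ j) / w $ i" if "i < m" for i
      using that unfolding c_def by simp
    then show ?thesis
      unfolding eigenvector_iff_border[OF A w] x_def by (simp cong: sum.cong_simp)
  qed
  have perron: "perron_vector A w \<longleftrightarrow> (\<exists>r. eigenvector A w r)"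
    if "A \<in> reciprocal_mats (Suc m)" for A
    using reciprocal_matsD(1)[OF that] w unfolding perron_vector_def by auto
  \<comment> \<open>Positivity of the last column is what forces the eigenvalue beyond all poles.\<close>
  have eq_border: "(\<forall>i\<in>{..<m}. c i < r) \<and> (\<Sum>i<m. 1 / (r - c i)) = r - 1
      \<and> A = reciprocal_border m B (x r)"
    if A: "A \<in> reciprocal_mats (Suc m)" and del: "mat_delete A m m = B"
      and r: "eigenvector A w r" for A r
  proof -
    have col: "\<forall>i<m. A $$ (i, m) = x r i" and sec: "(\<Sum>i<m. 1 / (r - c i)) = r - 1"
      using eigen[OF A del] r by auto
    have "0 < A $$ (i, m)" if "i < m" for i
      using that by (intro reciprocal_matsD[OF A]) auto
    then have "\<forall>i<m. c i < r" using col x_pos by metis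
    moreover have "A = reciprocal_border m B (x r)"
      using reciprocal_mat_eq_border[OF A, of "x r"] col del by simp
    ultimately show ?thesis using sec by simp
  qed
  from secular obtain r where r: "\<forall>i\<in>{..<m}. c i < r" "(\<Sum>i<m. 1 / (r - c i)) = r - 1"
    by blast
  let ?A = "reciprocal_border m B (x r)"
  have A: "?A \<in> reciprocal_mats (Suc m)"
    using r(1) x_pos by (intro reciprocal_border_reciprocal B) auto
  have del: "mat_delete ?A m m = B"
    by (intro mat_delete_reciprocal_border reciprocal_matsD(1) B)
  have "\<forall>i<m. ?A $$ (i, m) = x r i" by (simp add: reciprocal_border_def)
  then have "eigenvector ?A w r" using eigen[OF A del] r(2) by blast
  then have "perron_vector ?A w" using perron[OF A] by blast
  moreover have "A' = ?A"
    if A': "A' \<in> reciprocal_mats (Suc m)" "perron_vector A' w" "mat_delete A' m m = B" for A'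
  proof -
    obtain s where "eigenvector A' w s" using perron[OF A'(1)] A'(2) by blast
    note s = eq_border[OF A'(1,3) this]
    have "s = r" using secular s r by blast
    then show ?thesis using s by blast
  qed
  ultimately have "\<exists>!A. A \<in> reciprocal_mats (Suc m) \<and> perron_vector A w \<and> mat_delete A m m = B"
    using A del by blast
  then show ?thesis unfolding n by simp
qed

end
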